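(* Let $P(t)$ denote the number of pure $O$-sequences of socle degree $3$ and type $t$ (of any codimension). Then $\displaystyle\lim_{t\to\infty}\frac{P(t)}{t^2}=\frac92$.
   Context: A monomial order ideal is a finite nonempty set of monomials closed under taking divisors; it is pure of type $t$ if it has exactly $t$ maximal monomials under divisibility, all of the same degree $e$ (the socle degree). A pure $O$-sequence is the vector $(h_0,\dots,h_e)$ counting the monomials of each degree in a pure monomial order ideal; its type is $h_e$. Thus pure $O$-sequences of socle degree 3 and type $t$ have the form $(1,r,a,t)$. *)

theory Defs
  imports Complex_Main "HOL-Library.Multiset"
begin

text \<open>A monomial is the multiset of its variables: divisibility is \<open>\<subseteq>#\<close>, and the degree
  is \<open>size\<close>.\<close>

definition monomial_order_ideal :: "'v multiset set \<Rightarrow> bool" where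
  "monomial_order_ideal X \<longleftrightarrow>
     finite X \<and> X \<noteq> {} \<and> (\<forall>m\<in>X. \<forall>d. d \<subseteq># m \<longrightarrow> d \<in> X)"

definition maximal_monomials :: "'v multiset set \<Rightarrow> 'v multiset set" where
  "maximal_monomials X = {m \<in> X. \<forall>n\<in>X. m \<subseteq># n \<longrightarrow> n = m}"

definition pure_order_ideal :: "nat \<Rightarrow> nat \<Rightarrow> 'v multiset set \<Rightarrow> bool" where
  "pure_order_ideal e t X \<longleftrightarrow>
     monomial_order_ideal X \<and> card (maximal_monomials X) = t \<and>
     (\<forall>m\<in>maximal_monomials X. size m = e)"

definition h_vector :: "nat \<Rightarrow> 'v multiset set \<Rightarrow> nat list" where
  "h_vector e X = map (\<lambda>i. card {m \<in> X. size m = i}) [0..<Suc e]"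

text \<open>The variables are indexed by \<open>nat\<close>. An order ideal is finite, so it involves only finitely
  many of them, and no bound on their number (the codimension) is imposed.\<close>

definition pure_O_sequence :: "nat list \<Rightarrow> bool" where
  "pure_O_sequence h \<longleftrightarrow>
     (\<exists>(X :: nat multiset set) e t. pure_order_ideal e t X \<and> h = h_vector e X)"

definition socle_degree :: "nat list \<Rightarrow> nat" where
  "socle_degree h = length h - 1"

definition seq_type :: "nat list \<Rightarrow> nat" where
  "seq_type h = h ! socle_degree h"

definition num_pure_O_sequences :: "nat \<Rightarrow> nat \<Rightarrow> nat" where
  "num_pure_O_sequences e t =
     card {h. pure_O_sequence h \<and> socle_degree h = e \<and> seq_type h = t}"

end

theory Submission
  imports Defs "HOL-Real_Asymp.Real_Asymp"
begin

text \<open>For a sequence \<open>(1, r, a, t)\<close>, adding the socle monomials one at a time creates at least as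
  many new quadratic divisors as new variables, so \<open>r \<le> a \<le> 3t\<close>; this triangle has area
  \<open>9/2 t\<^sup>2\<close>. Conversely, order ideals in disjoint sets of variables add up \<open>(r, a, t)\<close>, and the
  three vertices of the triangle \<open>(r/t, a/t)\<close> are approached by blocks of monomials
  \<open>x\<^sub>i y\<^sub>j z\<^sub>k\<close>: \<open>(0, 0)\<close> by all of them with \<open>i, j, k < m\<close>, \<open>(0, 3)\<close> by those with \<open>k = i + j\<close>,
  and \<open>(3, 3)\<close> by single monomials. A bounded number of small blocks corrects residues modulo 3,
  so all integer points at distance of order \<open>t\<^sup>2\<^sup>/\<^sup>3\<close> from the boundary are attained.\<close>

section \<open>Divisors of a set of cubics and the bounds on their number\<close>

text \<open>Stated for the generators rather than for the ideal: when \<open>G\<close> is the set of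
  cubics of a pure ideal of socle degree 3, these are the graded pieces of that ideal.\<close>

definition level :: "nat \<Rightarrow> 'v multiset set \<Rightarrow> 'v multiset set" where
  "level i G = {d. size d = i \<and> (\<exists>m\<in>G. d \<subseteq># m)}"

lemma level_Un: "level i (G \<union> H) = level i G \<union> level i H"
  by (auto simp: level_def)

lemma size_3_cases:
  assumes "size m = 3"
  obtains x y z where "m = {#x, y, z#}"
proof -
  have "size m = Suc 2" using assms by simp
  then obtain x m1 where 1: "m = add_mset x m1" "size m1 = Suc 1"
    using size_eq_Suc_imp_eq_union[of m 2] by auto
  then obtain y m2 where 2: "m1 = add_mset y m2" "size m2 = Suc 0"
    using size_eq_Suc_imp_eq_union[of m1 1] by auto
  then obtain z where "m2 = {#z#}" by (metis One_nat_def size_1_singleton_mset)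
  with 1 2 that show thesis by blast
qed

lemma level_1_singleton: "level (Suc 0) {{#x, y, z#}} = {{#x#}, {#y#}, {#z#}}"
proof -
  have "d \<in> {{#x#}, {#y#}, {#z#}}" if d: "size d = Suc 0" "d \<subseteq># {#x, y, z#}" for d
  proof -
    obtain u where u: "d = {#u#}" using d(1) by (metis One_nat_def size_1_singleton_mset)
    with d(2) have "u \<in># {#x, y, z#}" by (simp add: mset_subset_eq_insertD)
    with u show ?thesis by auto
  qed
  then show ?thesis by (auto simp: level_def)
qed

text \<open>Deleting one variable from a cubic is the only way to get a quadratic divisor, which
  leaves three candidates.\<close>

lemma level_2_singleton: "level 2 {{#x, y, z#}} = {{#x, y#}, {#x, z#}, {#y, z#}}"
proof -
  have "d \<in> {{#x, y#}, {#x, z#}, {#y, z#}}" if d: "size d = 2" "d \<subseteq># {#x, y, z#}" for d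
  proof -
    obtain c where c: "{#x, y, z#} = d + c" using d(2) mset_subset_eq_exists_conv by blast
    then have "size {#x, y, z#} = size d + size c" by simp
    then have "size c = 1" using d(1) by simp
    then obtain u where u: "c = {#u#}" using size_1_singleton_mset by blast
    with c have "u \<in># {#x, y, z#}" by simp
    moreover have "d = {#x, y, z#} - {#u#}" using c u by simp
    ultimately show ?thesis by (auto simp: add_mset_commute)
  qed
  then show ?thesis by (auto simp: level_def)
qed

lemma finite_level:
  assumes "finite G"
  shows "finite (level i G)"
proof -
  have "level i G \<subseteq> (\<Union>m\<in>G. {d. d \<subseteq># m})" by (auto simp: level_def)
  moreover have "finite {d. d \<subseteq># m}" for m :: "'a multiset"
  proof (rule finite_subset)
    \<comment> \<open>A submultiset of \<open>m\<close> is listed by some \<open>xs\<close> over the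
      variables of \<open>m\<close>, no longer than \<open>size m\<close>, and there are finitely
      many such lists.\<close>
    show "finite (mset ` {xs. set xs \<subseteq> set_mset m \<and> length xs \<le> size m})"
      by (intro finite_imageI finite_lists_length_le) simp
    show "{d. d \<subseteq># m} \<subseteq> mset ` {xs. set xs \<subseteq> set_mset m \<and> length xs \<le> size m}"
    proof
      fix d assume "d \<in> {d. d \<subseteq># m}"
      moreover obtain xs where "d = mset xs" using ex_mset[of d] by blast
      ultimately show "d \<in> mset ` {xs. set xs \<subseteq> set_mset m \<and> length xs \<le> size m}"
        using set_mset_mono[of d m] size_mset_mono[of d m] by auto
    qed
  qed
  ultimately show ?thesis using assms finite_subset by blast
qed

lemma card_level_2_le:
  assumes "finite G" "\<forall>m\<in>G. size m = 3"
  shows "card (level 2 G) \<le> 3 * card G"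
  using assms
proof (induction G rule: finite_induct)
  case empty
  then show ?case by (simp add: level_def)
next
  case (insert m G)
  obtain x y z where m: "m = {#x, y, z#}" using insert.prems size_3_cases by blast
  have "card (level 2 {m}) \<le> 3"
    by (simp add: m level_2_singleton card_insert_if)
  moreover have "card (level 2 (insert m G)) \<le> card (level 2 {m}) + card (level 2 G)"
    using card_Un_le level_Un[of 2 "{m}" G] by (metis insert_is_Un)
  moreover have "card (level 2 G) \<le> 3 * card G" using insert by simp
  ultimately show ?case using insert by simp
qed

text \<open>Three distinct variables are matched cyclically: x to xy, y to yz, z to xz. For xxy, x
  goes to xx and y to xy. Each variable divides its image, so a variable that is new in a larger set
  of cubics has a new image too.\<close>

lemma variables_inject_into_level_2:
  assumes "size m = 3"
  shows "\<exists>\<phi>. inj_on \<phi> (level (Suc 0) {m}) \<and>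
    (\<forall>v\<in>level (Suc 0) {m}. \<phi> v \<in> level 2 {m} \<and> v \<subseteq># \<phi> v)"
proof -
  have rep: ?thesis if "m = {#x, x, y#}" for x y
  proof (intro exI)
    let ?\<phi> = "\<lambda>v. if v = {#x#} then {#x, x#} else {#x, y#}"
    show "inj_on ?\<phi> (level (Suc 0) {m}) \<and>
      (\<forall>v\<in>level (Suc 0) {m}. ?\<phi> v \<in> level 2 {m} \<and> v \<subseteq># ?\<phi> v)"
      unfolding that level_1_singleton level_2_singleton by (auto simp: inj_on_def)
  qed
  obtain x y z where m: "m = {#x, y, z#}" using assms size_3_cases by blast
  consider "x = y" | "y = z" | "x = z" | "distinct [x, y, z]" by auto
  then show ?thesis
  proof cases
    case 4
    let ?\<phi> = "\<lambda>v. if v = {#x#} then {#x, y#} else if v = {#y#} then {#y, z#} else {#x, z#}"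
    have "inj_on ?\<phi> (level (Suc 0) {m}) \<and>
      (\<forall>v\<in>level (Suc 0) {m}. ?\<phi> v \<in> level 2 {m} \<and> v \<subseteq># ?\<phi> v)"
      unfolding m level_1_singleton level_2_singleton using 4
      by (auto simp: inj_on_def add_eq_conv_ex)
    then show ?thesis by blast
  qed (use rep[of x z] rep[of y x] rep[of x y] m in \<open>auto simp: add_mset_commute\<close>)
qed

lemma card_level_1_le_card_level_2:
  assumes "finite G" "\<forall>m\<in>G. size m = 3"
  shows "card (level (Suc 0) G) \<le> card (level 2 G)"
  using assms
proof (induction G rule: finite_induct)
  case empty
  then show ?case by (simp add: level_def)
next
  case (insert m G)
  let ?N = "\<lambda>i. level i {m} - level i G"
  have fin: "finite (level i G)" "finite (level i {m})" for i
    by (auto intro: finite_level insert.hyps)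
  have split: "card (level i (insert m G)) = card (level i G) + card (?N i)" for i
  proof -
    have "level i (insert m G) = level i G \<union> ?N i"
      using level_Un[of i "{m}" G] by auto
    then show ?thesis using card_Un_disjoint[of "level i G" "?N i"] fin by auto
  qed
  obtain \<phi> where \<phi>: "inj_on \<phi> (level (Suc 0) {m})"
    "\<And>v. v \<in> level (Suc 0) {m} \<Longrightarrow> \<phi> v \<in> level 2 {m} \<and> v \<subseteq># \<phi> v"
    using variables_inject_into_level_2[of m] insert.prems by auto
  \<comment> \<open>A quadratic divisor of \<open>m\<close> involving a new variable is itself new.\<close>
  have "\<phi> ` ?N (Suc 0) \<subseteq> ?N 2"
    using \<phi>(2) by (fastforce simp: level_def dest: subset_mset.order_trans)
  then have "card (?N (Suc 0)) \<le> card (?N 2)"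
    by (intro card_inj_on_le[of \<phi>]) (auto intro: inj_on_subset[OF \<phi>(1)] simp: fin)
  with insert split show ?case by simp
qed

section \<open>Pure order ideals of socle degree 3 as finite sets of cubics\<close>

lemma below_maximal_monomial:
  assumes "finite X" "d \<in> X"
  shows "\<exists>m\<in>maximal_monomials X. d \<subseteq># m"
proof -
  obtain m where "m \<in> X" "d \<subseteq># m" "\<forall>n\<in>X. m \<subseteq># n \<longrightarrow> m = n"
    using subset_mset.finite_has_maximal2[OF assms] by blast
  then show ?thesis by (auto simp: maximal_monomials_def)
qed

lemma h_vector_3: "h_vector 3 X =
  [card {m \<in> X. size m = 0}, card {m \<in> X. size m = Suc 0}, card {m \<in> X. size m = 2},
   card {m \<in> X. size m = 3}]"
  by (simp add: h_vector_def numeral_3_eq_3 numeral_2_eq_2)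

text \<open>Each element divides a maximal monomial, which is a cubic by purity, so the ideal is
  recovered from its cubics.\<close>

lemma pure_order_ideal_3_levels:
  assumes "pure_order_ideal 3 t X"
  shows "finite {m \<in> X. size m = 3}"
    and "{d \<in> X. size d = i} = level i {m \<in> X. size m = 3}"
proof -
  have X: "finite X" "\<And>m d. m \<in> X \<Longrightarrow> d \<subseteq># m \<Longrightarrow> d \<in> X"
    and mx: "\<And>m. m \<in> maximal_monomials X \<Longrightarrow> size m = 3"
    using assms unfolding pure_order_ideal_def monomial_order_ideal_def by blast+
  show "finite {m \<in> X. size m = 3}" using X by simp
  have "\<exists>m\<in>X. size m = 3 \<and> d \<subseteq># m" if "d \<in> X" for d
    using below_maximal_monomial[OF X(1) that] mx by (auto simp: maximal_monomials_def)
  then show "{d \<in> X. size d = i} = level i {m \<in> X. size m = 3}"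
    using X(2) unfolding level_def by blast
qed

text \<open>Distinct cubics never divide each other and nothing of higher degree occurs, so the
  generators are exactly the maximal monomials.\<close>

lemma pure_order_ideal_generated:
  assumes "finite G" "G \<noteq> {}" "\<forall>m\<in>G. size m = 3"
  defines "X \<equiv> {d. \<exists>m\<in>G. d \<subseteq># m}"
  shows "pure_order_ideal 3 (card G) X"
    and "h_vector 3 X = [1, card (level (Suc 0) G), card (level 2 G), card G]"
proof -
  have le3: "d \<in> X \<Longrightarrow> size d \<le> 3" for d
    using assms(3) size_mset_mono by (force simp: X_def)
  have lev: "{m \<in> X. size m = i} = level i G" for i
    by (auto simp: X_def level_def)
  have top: "level 3 G = G"
    using assms(3) by (auto simp: level_def) (metis mset_subset_size subset_mset.le_less less_irrefl)
  have "X \<subseteq> (\<Union>i\<le>3. level i G)"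
    using le3 lev by blast
  then have fin: "finite X"
    by (rule finite_subset) (simp add: finite_level assms(1))
  have max: "maximal_monomials X = G"
  proof
    show "maximal_monomials X \<subseteq> G"
      by (auto simp: maximal_monomials_def X_def)
    have "n = m" if "m \<in> G" "n \<in> X" "m \<subseteq># n" for m n
      using le3[OF that(2)] assms(3) that mset_subset_size[of m n]
      by (force simp: subset_mset.le_less)
    then show "G \<subseteq> maximal_monomials X"
      by (auto simp: maximal_monomials_def X_def)
  qed
  have "monomial_order_ideal X"
    using fin assms(2) unfolding monomial_order_ideal_def X_def
    by (auto intro: subset_mset.order_trans)
  then show "pure_order_ideal 3 (card G) X"
    using assms(3) by (simp add: pure_order_ideal_def max)
  have "level 0 G = {{#}}" using assms(2) by (auto simp: level_def)
  then show "h_vector 3 X = [1, card (level (Suc 0) G), card (level 2 G), card G]"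
    unfolding h_vector_3 lev by (simp add: top)
qed

text \<open>Passing to cubics and generating from them are inverse operations, so sequences can be
  counted through sets \<open>G\<close>. For \<open>t = 0\<close> the empty \<open>G\<close> would
  give \<open>[1, 0, 0, 0]\<close> on the right, although it generates no order ideal.\<close>

lemma pure_O_sequences_3_eq:
  assumes "t > 0"
  shows "{h. pure_O_sequence h \<and> socle_degree h = 3 \<and> seq_type h = t} =
    {[1, card (level (Suc 0) G), card (level 2 G), t] | G :: nat multiset set.
      finite G \<and> card G = t \<and> (\<forall>m\<in>G. size m = 3)}" (is "?L = ?R")
proof
  show "?L \<subseteq> ?R"
  proof
    fix h assume "h \<in> ?L"
    then obtain X :: "nat multiset set" and e s where
      X: "pure_order_ideal e s X" "h = h_vector e X" "socle_degree h = 3" "seq_type h = t"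
      by (auto simp: pure_O_sequence_def)
    then have "e = 3" by (simp add: socle_degree_def h_vector_def)
    let ?G = "{m \<in> X. size m = 3}"
    note lev = pure_order_ideal_3_levels[OF X(1)[unfolded \<open>e = 3\<close>]]
    have t: "card ?G = t"
      using X(3,4) by (simp add: seq_type_def X(2) \<open>e = 3\<close> h_vector_3)
    then have "?G \<noteq> {}" using assms by force
    then have "level 0 ?G = {{#}}" by (auto simp: level_def)
    then have "h = [1, card (level (Suc 0) ?G), card (level 2 ?G), t]"
      unfolding X(2) \<open>e = 3\<close> h_vector_3 t
      using lev(2)[of 0] lev(2)[of "Suc 0"] lev(2)[of 2] by simp
    then show "h \<in> ?R" using lev(1) t by blast
  qed
  show "?R \<subseteq> ?L"
  proof
    fix h assume "h \<in> ?R"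
    then obtain G :: "nat multiset set" where
      G: "finite G" "card G = t" "\<forall>m\<in>G. size m = 3"
      "h = [1, card (level (Suc 0) G), card (level 2 G), t]" by blast
    then have "G \<noteq> {}" using assms by auto
    from pure_order_ideal_generated[OF G(1) this G(3)] have "pure_O_sequence h"
      unfolding pure_O_sequence_def G(4) G(2)[symmetric] by metis
    then show "h \<in> ?L" by (simp add: G(4) socle_degree_def seq_type_def)
  qed
qed

section \<open>Disjoint sums of tripartite sets of cubics\<close>

text \<open>A triple \<open>(i, j, k)\<close> encodes the monomial \<open>x\<^sub>i y\<^sub>j z\<^sub>k\<close> in three disjoint families of variables.\<close>

definition realizable :: "nat \<Rightarrow> nat \<Rightarrow> nat \<Rightarrow> bool" where
  "realizable r a t \<longleftrightarrow> (\<exists>T :: (nat \<times> nat \<times> nat) set. finite T \<and> card T = t \<and>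
     r = card ((\<lambda>(i, j, k). i) ` T) + card ((\<lambda>(i, j, k). j) ` T) + card ((\<lambda>(i, j, k). k) ` T) \<and>
     a = card ((\<lambda>(i, j, k). (i, j)) ` T) + card ((\<lambda>(i, j, k). (i, k)) ` T)
       + card ((\<lambda>(i, j, k). (j, k)) ` T))"

text \<open>The three families are the variables with index 0, 1, 2 modulo 3. Divisors of different
  shapes then never coincide, and each projection of \<open>T\<close> counts the divisors of one
  shape.\<close>

lemma realizable_imp_levels:
  assumes "realizable r a t"
  shows "\<exists>G :: nat multiset set. finite G \<and> card G = t \<and> (\<forall>m\<in>G. size m = 3) \<and>
    card (level (Suc 0) G) = r \<and> card (level 2 G) = a"
proof -
  obtain T :: "(nat \<times> nat \<times> nat) set" where T: "finite T" "card T = t"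
    "r = card ((\<lambda>(i, j, k). i) ` T) + card ((\<lambda>(i, j, k). j) ` T) + card ((\<lambda>(i, j, k). k) ` T)"
    "a = card ((\<lambda>(i, j, k). (i, j)) ` T) + card ((\<lambda>(i, j, k). (i, k)) ` T)
       + card ((\<lambda>(i, j, k). (j, k)) ` T)"
    using assms unfolding realizable_def by blast
  define x y z :: "nat \<Rightarrow> nat" where
    xyz: "x = (\<lambda>i. 3 * i)" "y = (\<lambda>i. 3 * i + 1)" "z = (\<lambda>i. 3 * i + 2)"
  have sep: "x i = x j \<longleftrightarrow> i = j" "y i = y j \<longleftrightarrow> i = j" "z i = z j \<longleftrightarrow> i = j"
    "x i \<noteq> y j" "y j \<noteq> x i" "x i \<noteq> z j" "z j \<noteq> x i" "y i \<noteq> z j" "z j \<noteq> y i" for i j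
    unfolding xyz by presburger+
  define g where "g = (\<lambda>(i, j, k). {#x i, y j, z k#})"
  have inj: "inj_on g T"
    by (auto simp: inj_on_def g_def sep add_eq_conv_ex)
  have inj2: "inj (\<lambda>(i, j). {#x i, y j#})" "inj (\<lambda>(i, j). {#x i, z j#})"
    "inj (\<lambda>(i, j). {#y i, z j#})"
    by (auto simp: inj_on_def sep add_eq_conv_ex)
  have lev: "level i (g ` T) = (\<Union>p\<in>T. level i {g p})" for i
    by (auto simp: level_def)
  have l1: "level (Suc 0) (g ` T) = (\<lambda>i. {#x i#}) ` (\<lambda>(i, j, k). i) ` T
      \<union> (\<lambda>i. {#y i#}) ` (\<lambda>(i, j, k). j) ` T \<union> (\<lambda>i. {#z i#}) ` (\<lambda>(i, j, k). k) ` T"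
    unfolding lev by (auto simp: g_def level_1_singleton image_iff split: prod.splits) force+
  have l2: "level 2 (g ` T) = (\<lambda>(i, j). {#x i, y j#}) ` (\<lambda>(i, j, k). (i, j)) ` T
      \<union> (\<lambda>(i, j). {#x i, z j#}) ` (\<lambda>(i, j, k). (i, k)) ` T
      \<union> (\<lambda>(i, j). {#y i, z j#}) ` (\<lambda>(i, j, k). (j, k)) ` T"
    unfolding lev by (auto simp: g_def level_2_singleton image_iff split: prod.splits) force+
  have "card (level (Suc 0) (g ` T)) = r"
    unfolding l1 T(3)
    by (subst card_Un_disjoint, use T(1) in simp, use T(1) in simp, force simp: sep)+
      (simp add: card_image inj_on_def sep)
  moreover have "card (level 2 (g ` T)) = a"
    unfolding l2 T(4)
    by (subst card_Un_disjoint, use T(1) in simp, use T(1) in simp,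
        force simp: sep add_eq_conv_ex)+
      (simp add: card_image[OF inj_on_subset[OF inj2(1)]] card_image[OF inj_on_subset[OF inj2(2)]]
         card_image[OF inj_on_subset[OF inj2(3)]])
  moreover have "\<forall>m\<in>g ` T. size m = 3" by (auto simp: g_def)
  ultimately show ?thesis
    using T(1,2) inj by (intro exI[of _ "g ` T"]) (simp add: card_image)
qed

lemma realizable_0: "realizable 0 0 0"
  unfolding realizable_def by (intro exI[of _ "{}"]) simp

text \<open>Relabelling one set by even and the other by odd indices makes their variables disjoint,
  so all seven cardinalities add.\<close>

lemma realizable_add:
  assumes "realizable r a t" "realizable r' a' t'"
  shows "realizable (r + r') (a + a') (t + t')"
proof -
  obtain T :: "(nat \<times> nat \<times> nat) set" where T: "finite T" "card T = t"
    "r = card ((\<lambda>(i, j, k). i) ` T) + card ((\<lambda>(i, j, k). j) ` T) + card ((\<lambda>(i, j, k). k) ` T)"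
    "a = card ((\<lambda>(i, j, k). (i, j)) ` T) + card ((\<lambda>(i, j, k). (i, k)) ` T)
       + card ((\<lambda>(i, j, k). (j, k)) ` T)"
    using assms(1) unfolding realizable_def by blast
  obtain U :: "(nat \<times> nat \<times> nat) set" where U: "finite U" "card U = t'"
    "r' = card ((\<lambda>(i, j, k). i) ` U) + card ((\<lambda>(i, j, k). j) ` U) + card ((\<lambda>(i, j, k). k) ` U)"
    "a' = card ((\<lambda>(i, j, k). (i, j)) ` U) + card ((\<lambda>(i, j, k). (i, k)) ` U)
       + card ((\<lambda>(i, j, k). (j, k)) ` U)"
    using assms(2) unfolding realizable_def by blast
  define e o' :: "nat \<Rightarrow> nat" where eo: "e = (\<lambda>i. 2 * i)" "o' = (\<lambda>i. 2 * i + 1)"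
  have sep: "e i = e j \<longleftrightarrow> i = j" "o' i = o' j \<longleftrightarrow> i = j" "e i \<noteq> o' j" "o' j \<noteq> e i" for i j
    unfolding eo by presburger+
  let ?V = "(\<lambda>(i, j, k). (e i, e j, e k)) ` T \<union> (\<lambda>(i, j, k). (o' i, o' j, o' k)) ` U"
  \<comment> \<open>One statement serves the identity and all six projections: \<open>q\<close>
    projects before relabelling, \<open>p\<close> after it, and \<open>f\<close>, \<open>f'\<close>
    are the relabellings induced on projected values.\<close>
  have card_split: "card (p ` ?V) = card (q ` T) + card (q ` U)"
    if "\<And>u. p ((\<lambda>(i, j, k). (e i, e j, e k)) u) = f (q u)"
      "\<And>u. p ((\<lambda>(i, j, k). (o' i, o' j, o' k)) u) = f' (q u)"
      "inj f" "inj f'" "\<And>u v. f u \<noteq> f' v"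
    for p :: "nat \<times> nat \<times> nat \<Rightarrow> 'b" and q :: "nat \<times> nat \<times> nat \<Rightarrow> 'c" and f f'
  proof -
    have "p ` ?V = f ` q ` T \<union> f' ` q ` U"
      unfolding image_Un image_image that(1,2) ..
    moreover have "f ` q ` T \<inter> f' ` q ` U = {}" using that(5) by blast
    moreover have "card (f ` A) = card A" "card (f' ` A) = card A" for A
      using that(3,4) by (meson card_image inj_on_subset subset_UNIV)+
    ultimately show ?thesis using T(1) U(1) by (simp add: card_Un_disjoint)
  qed
  have inj1: "inj e" "inj o'" by (auto simp: inj_on_def sep)
  have inj2: "inj (\<lambda>p. (e (fst p), e (snd p)))" "inj (\<lambda>p. (o' (fst p), o' (snd p)))"
    by (auto simp: inj_on_def sep prod_eq_iff)
  have "card ((\<lambda>u. u) ` ?V) = card ((\<lambda>u. u) ` T) + card ((\<lambda>u. u) ` U)"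
    by (rule card_split[of _ "map_prod e (map_prod e e)" _ "map_prod o' (map_prod o' o')"])
      (auto simp: inj1 prod.inj_map sep)
  moreover note
    card_split[of "\<lambda>(i, j, k). i" e "\<lambda>(i, j, k). i" o']
    card_split[of "\<lambda>(i, j, k). j" e "\<lambda>(i, j, k). j" o']
    card_split[of "\<lambda>(i, j, k). k" e "\<lambda>(i, j, k). k" o']
    card_split[of "\<lambda>(i, j, k). (i, j)" "\<lambda>p. (e (fst p), e (snd p))" "\<lambda>(i, j, k). (i, j)" "\<lambda>p. (o' (fst p), o' (snd p))"]
    card_split[of "\<lambda>(i, j, k). (i, k)" "\<lambda>p. (e (fst p), e (snd p))" "\<lambda>(i, j, k). (i, k)" "\<lambda>p. (o' (fst p), o' (snd p))"]
    card_split[of "\<lambda>(i, j, k). (j, k)" "\<lambda>p. (e (fst p), e (snd p))" "\<lambda>(i, j, k). (j, k)" "\<lambda>p. (o' (fst p), o' (snd p))"]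
  ultimately show ?thesis
    unfolding realizable_def using T(1) U(1)
    by (intro exI[of _ ?V])
      (simp add: T(2-) U(2-) inj1 inj2 sep case_prod_beta)
qed

lemma realizable_mult:
  assumes "realizable r a t"
  shows "realizable (n * r) (n * a) (n * t)"
  by (induction n) (simp_all add: realizable_0 realizable_add assms)

section \<open>Building blocks\<close>

text \<open>The last two blocks are pairs of cubics sharing a quadratic divisor or only a variable.
  Modulo 3 their \<open>(r, a)\<close> are (1, 2) and (2, 0), which generate all pairs of
  residues.\<close>

lemma realizable_small: "realizable 3 3 1" "realizable 4 5 2" "realizable 5 6 2"
proof -
  show "realizable 3 3 1"
    unfolding realizable_def by (intro exI[of _ "{(0, 0, 0)}"]) simp
  show "realizable 4 5 2"
    unfolding realizable_def by (intro exI[of _ "{(0, 0, 0), (1, 0, 0)}"]) simp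
  show "realizable 5 6 2"
    unfolding realizable_def by (intro exI[of _ "{(0, 0, 0), (1, 1, 0)}"]) simp
qed

text \<open>The three coordinate faces \<open>?B\<close> of the cube already project onto every
  index and every pair of indices. Any \<open>T\<close> between \<open>?B\<close> and the whole cube
  therefore has the same \<open>r\<close> and \<open>a\<close>, while its size is free.\<close>

lemma realizable_cube:
  assumes "3 * m\<^sup>2 \<le> t" "t \<le> m ^ 3"
  shows "realizable (3 * m) (3 * m\<^sup>2) t"
proof (cases "m = 0")
  case True
  then show ?thesis using assms realizable_0 by simp
next
  case False
  let ?I = "{..<m}"
  let ?B = "(?I \<times> ?I \<times> {0}) \<union> (?I \<times> {0} \<times> ?I) \<union> ({0} \<times> ?I \<times> ?I)"
  have "card ?B \<le> card (?I \<times> ?I \<times> {0::nat}) + card (?I \<times> {0::nat} \<times> ?I) + card ({0::nat} \<times> ?I \<times> ?I)"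
    by (meson card_Un_le add_right_mono order_trans)
  then have "card ?B \<le> t" using assms(1) by (simp add: power2_eq_square)
  moreover have "t \<le> card (?I \<times> ?I \<times> ?I)"
    using assms(2) by (simp add: power3_eq_cube mult.assoc)
  moreover have "?B \<subseteq> ?I \<times> ?I \<times> ?I" using False by auto
  ultimately obtain T where T: "?B \<subseteq> T" "T \<subseteq> ?I \<times> ?I \<times> ?I" "card T = t"
    using exists_subset_between[of ?B t "?I \<times> ?I \<times> ?I"] by auto
  have inT: "(i, j, 0) \<in> T" "(i, 0, j) \<in> T" "(0, i, j) \<in> T" if "i < m" "j < m" for i j
    using T(1) that by auto
  have lessT: "i < m" "j < m" "k < m" if "(i, j, k) \<in> T" for i j k
    using T(2) that by auto
  have "(\<lambda>(i, j, k). i) ` T = {i. \<exists>j k. (i, j, k) \<in> T}"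
    "(\<lambda>(i, j, k). j) ` T = {j. \<exists>i k. (i, j, k) \<in> T}"
    "(\<lambda>(i, j, k). k) ` T = {k. \<exists>i j. (i, j, k) \<in> T}"
    "(\<lambda>(i, j, k). (i, j)) ` T = {(i, j). \<exists>k. (i, j, k) \<in> T}"
    "(\<lambda>(i, j, k). (i, k)) ` T = {(i, k). \<exists>j. (i, j, k) \<in> T}"
    "(\<lambda>(i, j, k). (j, k)) ` T = {(j, k). \<exists>i. (i, j, k) \<in> T}"
    by force+
  moreover have "{i. \<exists>j k. (i, j, k) \<in> T} = ?I" "{j. \<exists>i k. (i, j, k) \<in> T} = ?I"
    "{k. \<exists>i j. (i, j, k) \<in> T} = ?I" "{(i, j). \<exists>k. (i, j, k) \<in> T} = ?I \<times> ?I"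
    "{(i, k). \<exists>j. (i, j, k) \<in> T} = ?I \<times> ?I" "{(j, k). \<exists>i. (i, j, k) \<in> T} = ?I \<times> ?I"
    using False by (auto simp: set_eq_iff dest: lessT) (metis inT gr0I)+
  moreover have "finite T" using T(2) finite_subset by blast
  ultimately show ?thesis
    unfolding realizable_def using T(3)
    by (intro exI[of _ T]) (simp add: power2_eq_square)
qed

text \<open>The triples \<open>(i, j, i + j)\<close> are determined by any two of their entries, so each of them
  contributes three new pairs.\<close>

lemma realizable_linear:
  assumes "n > 0"
  shows "\<exists>\<rho>\<le>4 * n. \<forall>s. 2 * n \<le> s \<and> s \<le> n\<^sup>2 \<longrightarrow> realizable \<rho> (3 * s) s"
proof -
  let ?I = "{..<n}" and ?J = "{..<2 * n - 1}"
  \<comment> \<open>Along these two sides of the square, i + j runs through 0, ..., 2n - 2 and both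
    coordinates take all values. Every \<open>S\<close> containing \<open>?B\<close> thus uses the
    same 4n - 1 variables, independently of \<open>s\<close>.\<close>
  let ?B = "(?I \<times> {0}) \<union> ({n - 1} \<times> ?I)"
  have "realizable (n + n + (2 * n - 1)) (3 * s) s" if s: "2 * n \<le> s" "s \<le> n\<^sup>2" for s
  proof -
    have "card ?B \<le> card (?I \<times> {0::nat}) + card ({n - 1} \<times> ?I)"
      by (rule card_Un_le)
    then have "card ?B \<le> s" using s(1) by simp
    moreover have "s \<le> card (?I \<times> ?I)" using s(2) by (simp add: power2_eq_square)
    moreover have "?B \<subseteq> ?I \<times> ?I" using assms by auto
    ultimately obtain S where S: "?B \<subseteq> S" "S \<subseteq> ?I \<times> ?I" "card S = s"
      using exists_subset_between[of ?B s "?I \<times> ?I"] by auto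
    let ?T = "(\<lambda>(i, j). (i, j, i + j)) ` S"
    have "k \<in> (\<lambda>(i, j). i + j) ` ?B" if "k < 2 * n - 1" for k
    proof (cases "k < n")
      case True
      then have "(k, 0) \<in> ?B" by simp
      then show ?thesis by (rule rev_image_eqI) simp
    next
      case False
      then have "(n - 1, k - (n - 1)) \<in> ?B" using that by auto
      then show ?thesis by (rule rev_image_eqI) (use False in simp)
    qed
    then have "?J \<subseteq> (\<lambda>(i, j). i + j) ` S" using S(1) by blast
    moreover have "(\<lambda>(i, j). i + j) ` S \<subseteq> ?J" using S(2) by auto
    ultimately have "(\<lambda>(i, j, k). k) ` ?T = ?J"
      by (simp add: image_image case_prod_beta)
    moreover have "(\<lambda>(i, j, k). i) ` ?T = ?I" "(\<lambda>(i, j, k). j) ` ?T = ?I"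
      using S(1,2) by (force simp: image_image case_prod_beta)+
    moreover have "card ?T = s" "card ((\<lambda>(i, j, k). (i, j)) ` ?T) = s"
      "card ((\<lambda>(i, j, k). (i, k)) ` ?T) = s" "card ((\<lambda>(i, j, k). (j, k)) ` ?T) = s"
      unfolding S(3)[symmetric] image_image
      by (rule card_image; force simp: inj_on_def)+
    moreover have "finite ?T" using S(2) finite_subset by blast
    ultimately show ?thesis
      unfolding realizable_def by (intro exI[of _ ?T]) simp
  qed
  then show ?thesis by (intro exI[of _ "n + n + (2 * n - 1)"]) auto
qed

section \<open>Realizing the interior of the triangle\<close>

text \<open>Modulo 3 the equations read r = i + 2j and a = 2i, so i = 2a and j = 2r + i. The bounds
  18 = 4*2 + 5*2 and 22 = 5*2 + 6*2 keep the remaining multiples of 3 nonnegative.\<close>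

lemma residue_decomposition:
  fixes r a :: nat
  assumes "18 \<le> r" "22 \<le> a"
  shows "\<exists>i j k b. i \<le> 2 \<and> j \<le> 2 \<and> r = 3 * k + 4 * i + 5 * j \<and> a = 3 * b + 5 * i + 6 * j"
proof -
  define i where "i = (2 * a) mod 3"
  define j where "j = (2 * r + i) mod 3"
  have le: "i \<le> 2" "j \<le> 2" unfolding i_def j_def by auto
  define c d where "c = (2 * a) div 3" and "d = (2 * r + i) div 3"
  then have cd: "2 * a = 3 * c + i" "2 * r + i = 3 * d + j"
    unfolding i_def j_def by simp_all
  \<comment> \<open>Five times the equation for \<open>j\<close>, arranged without subtraction so as
    to exhibit the congruence in \<open>nat\<close>; \<open>a\<close> is treated in the same way
    below.\<close>
  have "r + 3 * (3 * r + 3 * i) = 4 * i + 5 * j + 3 * (5 * d)" using cd(2) by simp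
  then have "r mod 3 = (4 * i + 5 * j) mod 3" by (metis mod_mult_self2)
  moreover have "4 * i + 5 * j \<le> r" using le assms by linarith
  ultimately obtain k where k: "r = 4 * i + 5 * j + 3 * k" by (rule mod_eq_nat1E)
  have "a + 3 * (3 * a + 2 * j) = 5 * i + 6 * j + 3 * (5 * c)" using cd(1) by simp
  then have "a mod 3 = (5 * i + 6 * j) mod 3" by (metis mod_mult_self2)
  moreover have "5 * i + 6 * j \<le> a" using le assms by linarith
  ultimately obtain b where b: "a = 5 * i + 6 * j + 3 * b" by (rule mod_eq_nat1E)
  have "r = 3 * k + 4 * i + 5 * j" "a = 3 * b + 5 * i + 6 * j" using k b by simp_all
  with le show ?thesis by blast
qed

text \<open>The set is a sum of a cube block of type \<open>c\<close>, a linear block of type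
  \<open>s\<close>, \<open>k\<close> single cubics and at most four correcting pairs. Then
  \<open>r\<close> determines \<open>k\<close>, \<open>a\<close> determines \<open>s\<close>, and
  \<open>t\<close> determines \<open>c\<close>; the margins make \<open>s\<close> and
  \<open>c\<close> large enough for their blocks.\<close>

lemma realizable_region:
  assumes "m > 0" "t \<le> m ^ 3"
    and "25 * m\<^sup>2 \<le> r" "r + 25 * m\<^sup>2 \<le> a" "a + 25 * m\<^sup>2 \<le> 3 * t"
  shows "realizable r a t"
proof -
  define q where "q = m\<^sup>2"
  have q: "m \<le> q" "q > 0" "m ^ 3 \<le> q\<^sup>2"
    using assms(1) power_increasing[of 3 4 m]
    by (simp_all add: q_def self_le_power flip: power_mult)
  \<comment> \<open>Side length \<open>q\<close> = m^2 allows types up to m^4 \<ge> t, at a cost in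
    variables still of order m^2.\<close>
  obtain \<rho> where \<rho>: "\<rho> \<le> 4 * q"
    "\<And>s. 2 * q \<le> s \<Longrightarrow> s \<le> q\<^sup>2 \<Longrightarrow> realizable \<rho> (3 * s) s"
    using realizable_linear[OF q(2)] by blast
  define r' where "r' = r - 3 * m - \<rho>"
  define a' where "a' = a - 3 * q"
  \<comment> \<open>The constant 25 is 3 + 4 + 18 here, covering \<open>3 * m\<close>,
    \<open>\<rho>\<close> and the residue bound; for \<open>a'\<close> it is 3 + 22.\<close>
  have r': "r = r' + 3 * m + \<rho>" "18 \<le> r'"
    using assms(3) q \<rho>(1) unfolding r'_def q_def[symmetric] by auto
  have a': "a = a' + 3 * q" "r' + 22 \<le> a'" using assms(4) r' q unfolding a'_def q_def[symmetric] by auto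
  have "\<exists>i j k b. i \<le> 2 \<and> j \<le> 2 \<and> r' = 3 * k + 4 * i + 5 * j \<and> a' = 3 * b + 5 * i + 6 * j"
    using r'(2) a'(2) by (intro residue_decomposition) auto
  then obtain i j k b where ij: "i \<le> 2" "j \<le> 2" and
    k: "r' = 3 * k + 4 * i + 5 * j" and b: "a' = 3 * b + 5 * i + 6 * j" by blast
  \<comment> \<open>Linear block and single cubics both yield three quadratic divisors per cubic, so
    together they use \<open>b\<close> cubics; the cube block absorbs the type that is left.\<close>
  define s where "s = b - k"
  define c where "c = t - (b + 2 * i + 2 * j)"
  have s: "b = s + k" "2 * q \<le> s" "s \<le> t"
    using assms(3-5) r' a' k b ij q \<rho>(1) unfolding s_def q_def[symmetric] by linarith+
  have c: "t = c + (b + 2 * i + 2 * j)" "3 * q \<le> c"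
    using assms(3-5) r' a' k b ij q \<rho>(1) unfolding c_def q_def[symmetric] by linarith+
  have "realizable (3 * m) (3 * q) c"
    using realizable_cube[of m c] c assms(2) by (simp add: q_def)
  moreover have "realizable \<rho> (3 * s) s" using \<rho>(2) s q assms(2) by simp
  moreover note realizable_mult[OF realizable_small(1), of k]
    realizable_mult[OF realizable_small(2), of i] realizable_mult[OF realizable_small(3), of j]
  ultimately have "realizable (3 * m + (\<rho> + (k * 3 + (i * 4 + j * 5))))
    (3 * q + (3 * s + (k * 3 + (i * 5 + j * 6)))) (c + (s + (k * 1 + (i * 2 + j * 2))))"
    by (intro realizable_add)
  moreover have "3 * m + (\<rho> + (k * 3 + (i * 4 + j * 5))) = r" using r' k by simp
  moreover have "3 * q + (3 * s + (k * 3 + (i * 5 + j * 6))) = a" using a' b s by simp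
  moreover have "c + (s + (k * 1 + (i * 2 + j * 2))) = t" using c s by simp
  ultimately show ?thesis by simp
qed

section \<open>Counting lattice points and the limit\<close>

lemma card_triangle:
  "card {(r :: nat, a). r \<le> a \<and> a \<le> n} = (n + 1) * (n + 2) div 2"
proof -
  have "{(r, a). r \<le> a \<and> a \<le> n} = prod.swap ` (SIGMA a:{..n}. {..a})"
    by (force simp: image_iff)
  then have "card {(r, a). r \<le> a \<and> a \<le> n} = (\<Sum>a\<le>n. Suc a)"
    by (simp add: card_image)
  also have "\<dots> = (n + 1) * (n + 2) div 2" by (induction n) auto
  finally show ?thesis .
qed

lemma pure_O_sequences_3_subset:
  assumes "t > 0"
  shows "{h. pure_O_sequence h \<and> socle_degree h = 3 \<and> seq_type h = t} \<subseteq>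
    (\<lambda>(r, a). [1, r, a, t]) ` {(r, a). r \<le> a \<and> a \<le> 3 * t}"
proof -
  have "[1, card (level (Suc 0) G), card (level 2 G), t] \<in>
      (\<lambda>(r, a). [1, r, a, t]) ` {(r, a). r \<le> a \<and> a \<le> 3 * t}"
    if "finite G" "card G = t" "\<forall>m\<in>G. size m = 3" for G :: "nat multiset set"
    using card_level_1_le_card_level_2[OF that(1,3)] card_level_2_le[OF that(1,3)] that(2)
    by (intro image_eqI[of _ _ "(card (level (Suc 0) G), card (level 2 G))"]) auto
  then show ?thesis unfolding pure_O_sequences_3_eq[OF assms] by blast
qed

lemma finite_triangle: "finite {(r :: nat, a). r \<le> a \<and> a \<le> n}"
  by (rule finite_subset[of _ "{..n} \<times> {..n}"]) auto

lemma num_pure_O_sequences_upper: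
  assumes "t > 0"
  shows "num_pure_O_sequences 3 t \<le> (3 * t + 1) * (3 * t + 2) div 2"
  using surj_card_le[OF finite_triangle pure_O_sequences_3_subset[OF assms]]
  by (simp add: num_pure_O_sequences_def card_triangle)

text \<open>With M = 25 m^2, translation by (M, 2M) moves the triangle r \<le> a \<le> L into the
  region of realizable points: L + 2M = 3t - M leaves the margin M at each of the three
  sides.\<close>

lemma num_pure_O_sequences_lower:
  assumes "t > 0" "t \<le> m ^ 3" "25 * m\<^sup>2 \<le> t"
  defines "L \<equiv> 3 * (t - 25 * m\<^sup>2)"
  shows "(L + 1) * (L + 2) div 2 \<le> num_pure_O_sequences 3 t"
proof -
  let ?S = "{h. pure_O_sequence h \<and> socle_degree h = 3 \<and> seq_type h = t}"
  let ?D = "{(r :: nat, a). r \<le> a \<and> a \<le> L}"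
  let ?M = "25 * m\<^sup>2"
  let ?f = "\<lambda>(r, a). [1, r + ?M, a + 2 * ?M, t]"
  have "m > 0" using assms by (auto intro: gr0I)
  have "?f (r, a) \<in> ?S" if "r \<le> a" "a \<le> L" for r a
  proof -
    have "realizable (r + ?M) (a + 2 * ?M) t"
      using that assms by (intro realizable_region[OF \<open>m > 0\<close>]) auto
    from realizable_imp_levels[OF this] show ?thesis
      unfolding pure_O_sequences_3_eq[OF assms(1)] by force
  qed
  then have "?f ` ?D \<subseteq> ?S" by blast
  \<comment> \<open>Comparing cardinalities also requires \<open>?S\<close> to be finite, which the
    enclosing triangle provides.\<close>
  moreover have "inj_on ?f ?D" by (auto simp: inj_on_def)
  ultimately have "card ?D \<le> card ?S"
    using card_inj_on_le finite_surj[OF finite_triangle pure_O_sequences_3_subset[OF assms(1)]]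
    by blast
  then show ?thesis by (simp add: num_pure_O_sequences_def card_triangle)
qed

theorem theorem5p9:
  "(\<lambda>t. real (num_pure_O_sequences 3 t) / (real t)\<^sup>2) \<longlonglongrightarrow> 9 / 2"
proof (rule tendsto_sandwich)
  \<comment> \<open>The least m with t \<le> m^3; the margin 25 m^2 is then of order t^(2/3),
    negligible against t.\<close>
  define m where "m t = nat \<lceil>real t powr (1 / 3)\<rceil>" for t
  have cube: "t \<le> m t ^ 3" for t
  proof -
    have "real t = (real t powr (1 / 3)) ^ 3"
      by (cases "t = 0") (auto simp: powr_power)
    also have "\<dots> \<le> real (m t) ^ 3"
      by (intro power_mono) (auto simp: m_def)
    finally show ?thesis by (simp flip: of_nat_power)
  qed
  have lim: "(\<lambda>t. 25 * (real (m t))\<^sup>2 / real t) \<longlonglongrightarrow> 0"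
    unfolding m_def by real_asymp
  have "eventually (\<lambda>t. 25 * (real (m t))\<^sup>2 / real t < 1) sequentially"
    using lim by (rule order_tendstoD) simp
  then have "\<forall>\<^sub>F t in sequentially. t > 0 \<and> 25 * (m t)\<^sup>2 \<le> t"
    using eventually_gt_at_top[of 0]
  proof eventually_elim
    case (elim t)
    then have "real (25 * (m t)\<^sup>2) < real t" by simp
    then show ?case using elim by linarith
  qed
  then show "\<forall>\<^sub>F t in sequentially. (3 * (1 - 25 * (real (m t))\<^sup>2 / real t))\<^sup>2 / 2
      \<le> real (num_pure_O_sequences 3 t) / (real t)\<^sup>2"
  proof eventually_elim
    case (elim t)
    define L where "L = 3 * (t - 25 * (m t)\<^sup>2)"
    have L: "real L = real t * (3 * (1 - 25 * (real (m t))\<^sup>2 / real t))"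
      using elim by (simp add: L_def of_nat_diff field_simps)
    \<comment> \<open>Integer halving loses at most 1/2, which the dropped terms 3L + 2 absorb after
      doubling.\<close>
    have "L\<^sup>2 \<le> 2 * ((L + 1) * (L + 2) div 2)"
      by (simp add: power2_eq_square algebra_simps)
    also have "\<dots> \<le> 2 * num_pure_O_sequences 3 t"
      using num_pure_O_sequences_lower[of t "m t"] elim cube unfolding L_def
      by (intro mult_left_mono) auto
    finally have "real (L\<^sup>2) \<le> real (2 * num_pure_O_sequences 3 t)"
      by (rule of_nat_mono)
    then have "(real L)\<^sup>2 \<le> 2 * real (num_pure_O_sequences 3 t)" by simp
    then show ?case
      using elim unfolding L power_mult_distrib by (simp add: field_simps)
  qed
  show "\<forall>\<^sub>F t in sequentially. real (num_pure_O_sequences 3 t) / (real t)\<^sup>2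
      \<le> (3 * real t + 1) * (3 * real t + 2) / 2 / (real t)\<^sup>2"
    using eventually_gt_at_top[of 0]
  proof eventually_elim
    case (elim t)
    have "2 * num_pure_O_sequences 3 t \<le> (3 * t + 1) * (3 * t + 2)"
      using num_pure_O_sequences_upper[OF elim] by linarith
    then have "real (2 * num_pure_O_sequences 3 t) \<le> real ((3 * t + 1) * (3 * t + 2))"
      by (rule of_nat_mono)
    then show ?case by (intro divide_right_mono) (auto simp: algebra_simps)
  qed
  have "(\<lambda>t. (3 * (1 - 25 * (real (m t))\<^sup>2 / real t))\<^sup>2 / 2) \<longlonglongrightarrow> (3 * (1 - 0))\<^sup>2 / 2"
    by (intro tendsto_intros lim) simp
  then show "(\<lambda>t. (3 * (1 - 25 * (real (m t))\<^sup>2 / real t))\<^sup>2 / 2) \<longlonglongrightarrow> 9 / 2" by simp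
  show "(\<lambda>t. (3 * real t + 1) * (3 * real t + 2) / 2 / (real t)\<^sup>2) \<longlonglongrightarrow> 9 / 2"
    by real_asymp
qed

end
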